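(* Every continuous Yoneda-complete quasi-metric space $X, d$ is consonant in its $d$-Scott topology.
   Context: A quasi-metric on a set $X$ is a map $d \colon X \times X \to [0,+\infty]$ with $d(x,x)=0$, $d(x,z) \leq d(x,y)+d(y,z)$, and such that $d(x,y)=d(y,x)=0$ implies $x=y$. A formal ball is a pair $(x,r)$ with $x \in X$, $r \in \mathbb{R}_+ = [0,+\infty)$; formal balls are ordered by $(x,r) \leq^{d^+} (y,s)$ iff $d(x,y) \leq r-s$, forming a poset $\mathbf{B}(X,d)$, equipped with its Scott topology (the open sets are the upwards-closed sets $U$ such that every directed family having a supremum in $U$ intersects $U$). The $d$-Scott topology on $X$ is the coarsest one making $x \mapsto (x,0)$ continuous from $X$ to $\mathbf{B}(X,d)$. $X,d$ is Yoneda-complete iff $\mathbf{B}(X,d)$ is a dcpo (equivalently, every Cauchy-weightable net has a $d$-limit), and continuous Yoneda-complete iff $\mathbf{B}(X,d)$ is a continuous dcpo. Compact does not include any separation axiom; a saturated set is one that is an intersection of open sets. A topological space is consonant iff, for every Scott-open family $\mathcal{U}$ of open sets (Scott-open in the complete lattice of open subsets ordered by inclusion) and every $U \in \mathcal{U}$, there is a compact saturated set $Q \subseteq U$ such that every open neighborhood of $Q$ belongs to $\mathcal{U}$. *)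

theory Defs
  imports "HOL-Analysis.Analysis" "HOL-Algebra.Order"
begin

subsection \<open>Domain theory over posets with a carrier\<close>

definition directed_in :: "('a, 'b) gorder_scheme \<Rightarrow> 'a set \<Rightarrow> bool" where
  "directed_in L D \<longleftrightarrow>
     D \<subseteq> carrier L \<and> D \<noteq> {} \<and> (\<forall>x\<in>D. \<forall>y\<in>D. \<exists>z\<in>D. x \<sqsubseteq>\<^bsub>L\<^esub> z \<and> y \<sqsubseteq>\<^bsub>L\<^esub> z)"

definition dcpo :: "('a, 'b) gorder_scheme \<Rightarrow> bool" where
  "dcpo L \<longleftrightarrow> partial_order L \<and> (\<forall>D. directed_in L D \<longrightarrow> (\<exists>s. is_lub L s D))"

definition way_below :: "('a, 'b) gorder_scheme \<Rightarrow> 'a \<Rightarrow> 'a \<Rightarrow> bool" where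
  "way_below L x y \<longleftrightarrow>
     x \<in> carrier L \<and> y \<in> carrier L \<and>
     (\<forall>D s. directed_in L D \<longrightarrow> is_lub L s D \<longrightarrow> y \<sqsubseteq>\<^bsub>L\<^esub> s \<longrightarrow> (\<exists>z\<in>D. x \<sqsubseteq>\<^bsub>L\<^esub> z))"

definition continuous_dcpo :: "('a, 'b) gorder_scheme \<Rightarrow> bool" where
  "continuous_dcpo L \<longleftrightarrow>
     dcpo L \<and>
     (\<forall>x\<in>carrier L. directed_in L {y. way_below L y x} \<and> is_lub L x {y. way_below L y x})"

definition Scott_open :: "('a, 'b) gorder_scheme \<Rightarrow> 'a set \<Rightarrow> bool" where
  "Scott_open L U \<longleftrightarrow>
     U \<subseteq> carrier L \<and>
     (\<forall>x\<in>U. \<forall>y\<in>carrier L. x \<sqsubseteq>\<^bsub>L\<^esub> y \<longrightarrow> y \<in> U) \<and>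
     (\<forall>D s. directed_in L D \<longrightarrow> is_lub L s D \<longrightarrow> s \<in> U \<longrightarrow> D \<inter> U \<noteq> {})"

definition Scott_topology :: "('a, 'b) gorder_scheme \<Rightarrow> 'a topology" where
  "Scott_topology L = topology (Scott_open L)"

lemma istopology_Scott_open: "istopology (Scott_open L)"
  unfolding istopology_def
proof (intro conjI allI impI)
  fix U V assume U: "Scott_open L U" and V: "Scott_open L V"
  have "D \<inter> (U \<inter> V) \<noteq> {}" if D: "directed_in L D" and s: "is_lub L s D" "s \<in> U \<inter> V" for D s
  proof -
    obtain a b where ab: "a \<in> D" "a \<in> U" "b \<in> D" "b \<in> V"
      using U V D s unfolding Scott_open_def by blast
    then obtain c where "c \<in> D" "a \<sqsubseteq>\<^bsub>L\<^esub> c" "b \<sqsubseteq>\<^bsub>L\<^esub> c" "c \<in> carrier L"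
      using D unfolding directed_in_def by blast
    then show ?thesis using ab U V unfolding Scott_open_def by blast
  qed
  then show "Scott_open L (U \<inter> V)"
    using U V unfolding Scott_open_def by blast
next
  fix K assume K: "\<forall>U\<in>K. Scott_open L U"
  show "Scott_open L (\<Union>K)"
    unfolding Scott_open_def
  proof (intro conjI allI ballI impI)
    show "\<Union>K \<subseteq> carrier L"
      using K by (auto simp: Scott_open_def)
  next
    fix x y assume "x \<in> \<Union>K" "y \<in> carrier L" "x \<sqsubseteq>\<^bsub>L\<^esub> y"
    then show "y \<in> \<Union>K"
      using K by (auto simp: Scott_open_def)
  next
    fix D s assume D: "directed_in L D" "is_lub L s D" and "s \<in> \<Union>K"
    then obtain U where U: "U \<in> K" "s \<in> U" by blast
    then have "D \<inter> U \<noteq> {}"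
      using K D by (auto simp: Scott_open_def)
    then show "D \<inter> \<Union>K \<noteq> {}"
      using U by blast
  qed
qed

lemma openin_Scott_topology: "openin (Scott_topology L) U \<longleftrightarrow> Scott_open L U"
  by (simp add: Scott_topology_def istopology_Scott_open)

lemma topspace_Scott_topology: "topspace (Scott_topology L) = carrier L"
proof -
  have "Scott_open L (carrier L)"
    by (auto simp: Scott_open_def directed_in_def)
  moreover have "U \<subseteq> carrier L" if "Scott_open L U" for U
    using that by (simp add: Scott_open_def)
  ultimately show ?thesis
    unfolding topspace_def openin_Scott_topology by blast
qed


subsection \<open>Quasi-metric spaces and formal balls\<close>

locale Quasi_metric_space =
  fixes X :: "'a set" and d :: "'a \<Rightarrow> 'a \<Rightarrow> ennreal"
  assumes dist_self: "x \<in> X \<Longrightarrow> d x x = 0"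
    and triangle: "\<lbrakk>x \<in> X; y \<in> X; z \<in> X\<rbrakk> \<Longrightarrow> d x z \<le> d x y + d y z"
    and separated: "\<lbrakk>x \<in> X; y \<in> X; d x y = 0; d y x = 0\<rbrakk> \<Longrightarrow> x = y"

text \<open>The comparison takes place in the extended reals, so that it fails whenever
  \<open>r - s\<close> is negative; \<open>ennreal (r - s)\<close> would truncate negative differences to \<open>0\<close>.\<close>

definition formal_balls :: "'a set \<Rightarrow> ('a \<Rightarrow> 'a \<Rightarrow> ennreal) \<Rightarrow> ('a \<times> real) gorder" where
  "formal_balls X d =
     \<lparr> carrier = X \<times> {0..},
       eq = (=),
       le = (\<lambda>(x, r) (y, s). enn2ereal (d x y) \<le> ereal (r - s)) \<rparr>"

lemma (in Quasi_metric_space) partial_order_formal_balls: "partial_order (formal_balls X d)"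
proof
  fix a b c
  assume ab: "a \<sqsubseteq>\<^bsub>formal_balls X d\<^esub> b" and bc: "b \<sqsubseteq>\<^bsub>formal_balls X d\<^esub> c"
    and car: "a \<in> carrier (formal_balls X d)" "b \<in> carrier (formal_balls X d)"
      "c \<in> carrier (formal_balls X d)"
  obtain x r y s z t where eqs: "a = (x, r)" "b = (y, s)" "c = (z, t)"
    by (metis surj_pair)
  have "enn2ereal (d x z) \<le> enn2ereal (d x y + d y z)"
    using triangle[of x y z] car by (simp add: eqs formal_balls_def less_eq_ennreal.rep_eq)
  also have "\<dots> \<le> ereal (r - s) + ereal (s - t)"
    using ab bc by (simp add: eqs formal_balls_def plus_ennreal.rep_eq add_mono del: plus_ereal.simps)
  finally show "a \<sqsubseteq>\<^bsub>formal_balls X d\<^esub> c"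
    by (simp add: eqs formal_balls_def)
next
  fix a b
  assume ab: "a \<sqsubseteq>\<^bsub>formal_balls X d\<^esub> b" and ba: "b \<sqsubseteq>\<^bsub>formal_balls X d\<^esub> a"
    and car: "a \<in> carrier (formal_balls X d)" "b \<in> carrier (formal_balls X d)"
  obtain x r y s where eqs: "a = (x, r)" "b = (y, s)"
    by (metis surj_pair)
  have le: "enn2ereal (d x y) \<le> ereal (r - s)" "enn2ereal (d y x) \<le> ereal (s - r)"
    using ab ba by (simp_all add: eqs formal_balls_def)
  have "0 \<le> ereal (r - s)" "0 \<le> ereal (s - r)"
    using le enn2ereal_nonneg order_trans by blast+
  then have rs: "r = s" by simp
  have "enn2ereal (d x y) = 0" "enn2ereal (d y x) = 0"
    using le rs by (simp_all add: antisym zero_ereal_def[symmetric])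
  then have "d x y = 0" "d y x = 0"
    by (metis enn2ereal_inject zero_ennreal.rep_eq)+
  then show "a .=\<^bsub>formal_balls X d\<^esub> b"
    using separated[of x y] car rs by (simp add: eqs formal_balls_def)
qed (auto simp: formal_balls_def dist_self zero_ennreal.rep_eq zero_ereal_def)

definition Yoneda_complete :: "'a set \<Rightarrow> ('a \<Rightarrow> 'a \<Rightarrow> ennreal) \<Rightarrow> bool" where
  "Yoneda_complete X d \<longleftrightarrow> dcpo (formal_balls X d)"

definition continuous_Yoneda_complete :: "'a set \<Rightarrow> ('a \<Rightarrow> 'a \<Rightarrow> ennreal) \<Rightarrow> bool" where
  "continuous_Yoneda_complete X d \<longleftrightarrow> continuous_dcpo (formal_balls X d)"

definition d_Scott_topology :: "'a set \<Rightarrow> ('a \<Rightarrow> 'a \<Rightarrow> ennreal) \<Rightarrow> 'a topology" where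
  "d_Scott_topology X d =
     pullback_topology X (\<lambda>x. (x, 0)) (Scott_topology (formal_balls X d))"

lemma topspace_d_Scott_topology: "topspace (d_Scott_topology X d) = X"
  by (auto simp: d_Scott_topology_def topspace_pullback_topology topspace_Scott_topology
      formal_balls_def)

lemma continuous_map_d_Scott_topology:
  "continuous_map (d_Scott_topology X d) (Scott_topology (formal_balls X d)) (\<lambda>x. (x, 0))"
  using continuous_map_pullback[OF continuous_map_id]
  by (auto simp: d_Scott_topology_def comp_def)

lemma d_Scott_topology_coarsest:
  assumes "topspace T = X"
    and "continuous_map T (Scott_topology (formal_balls X d)) (\<lambda>x. (x, 0))"
    and "openin (d_Scott_topology X d) U"
  shows "openin T U"
proof -
  obtain V where V: "openin (Scott_topology (formal_balls X d)) V" "U = (\<lambda>x. (x, 0)) -` V \<inter> X"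
    using assms(3) unfolding d_Scott_topology_def openin_pullback_topology by blast
  then have "U = {x \<in> topspace T. (x, 0) \<in> V}"
    using assms(1) by auto
  then show ?thesis
    using openin_continuous_map_preimage[OF assms(2) V(1)] by simp
qed


subsection \<open>Consonance\<close>

definition opens_lattice :: "'a topology \<Rightarrow> 'a set gorder" where
  "opens_lattice T = \<lparr> carrier = {U. openin T U}, eq = (=), le = (\<subseteq>) \<rparr>"

definition saturated_in :: "'a topology \<Rightarrow> 'a set \<Rightarrow> bool" where
  "saturated_in T Q \<longleftrightarrow> (\<exists>\<F>. (\<forall>U\<in>\<F>. openin T U) \<and> Q = topspace T \<inter> \<Inter>\<F>)"

definition consonant :: "'a topology \<Rightarrow> bool" where
  "consonant T \<longleftrightarrow>
     (\<forall>\<U>. Scott_open (opens_lattice T) \<U> \<longrightarrow>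
       (\<forall>U\<in>\<U>. \<exists>Q. compactin T Q \<and> saturated_in T Q \<and> Q \<subseteq> U \<and>
          (\<forall>V. openin T V \<longrightarrow> Q \<subseteq> V \<longrightarrow> V \<in> \<U>)))"

end

theory Submission
  imports Defs
begin

text \<open>The balls of radius \<open>0\<close> form a \<open>G\<^sub>\<delta>\<close> subset of the continuous dcpo of formal balls,
  because the radius map is Scott-continuous. Given a Scott-open family \<open>\<U>\<close> and \<open>U \<in> \<U>\<close>, one
  chooses finite sets \<open>E\<^sub>0, E\<^sub>1, \<dots>\<close> of formal balls such that each \<open>E\<^sub>n\<^sub>+\<^sub>1\<close> lies in the
  \<open>n\<close>-th open set of the \<open>G\<^sub>\<delta>\<close> presentation and way above \<open>E\<^sub>n\<close>, while the trace on \<open>X\<close> of the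
  set of points way above \<open>E\<^sub>n\<close> stays in \<open>\<U>\<close>. By Koenig's lemma, every open set that contains the
  intersection \<open>Q\<close> of the upward closures of the \<open>E\<^sub>n\<close> contains some \<open>E\<^sub>n\<close>; so \<open>Q\<close> is compact and all
  its open neighbourhoods trace to members of \<open>\<U>\<close>.\<close>

subsection \<open>Continuous dcpos\<close>

definition way_above :: "('a, 'b) gorder_scheme \<Rightarrow> 'a set \<Rightarrow> 'a set" where
  "way_above L E = {y. \<exists>b\<in>E. way_below L b y}"

definition up_closure :: "('a, 'b) gorder_scheme \<Rightarrow> 'a set \<Rightarrow> 'a set" where
  "up_closure L E = {y \<in> carrier L. \<exists>b\<in>E. b \<sqsubseteq>\<^bsub>L\<^esub> y}"

lemma is_lub_carrier: "is_lub L s D \<Longrightarrow> s \<in> carrier L"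
  by (auto simp: least_def Upper_def)

lemma is_lub_upper: "\<lbrakk>is_lub L s D; x \<in> D; D \<subseteq> carrier L\<rbrakk> \<Longrightarrow> x \<sqsubseteq>\<^bsub>L\<^esub> s"
  by (auto simp: least_def Upper_def)

lemma is_lub_least:
  "\<lbrakk>is_lub L s D; D \<subseteq> carrier L; y \<in> carrier L; \<And>x. x \<in> D \<Longrightarrow> x \<sqsubseteq>\<^bsub>L\<^esub> y\<rbrakk> \<Longrightarrow> s \<sqsubseteq>\<^bsub>L\<^esub> y"
  by (auto simp: least_def Upper_def)

lemma is_lubI:
  assumes "s \<in> carrier L" "\<And>x. x \<in> D \<Longrightarrow> x \<sqsubseteq>\<^bsub>L\<^esub> s"
    and "\<And>y. \<lbrakk>y \<in> carrier L; \<And>x. \<lbrakk>x \<in> D; x \<in> carrier L\<rbrakk> \<Longrightarrow> x \<sqsubseteq>\<^bsub>L\<^esub> y\<rbrakk> \<Longrightarrow> s \<sqsubseteq>\<^bsub>L\<^esub> y"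
  shows "is_lub L s D"
  using assms by (auto simp: least_def Upper_def)

context partial_order
begin

lemma way_below_imp_le:
  assumes "way_below L x y"
  shows "x \<sqsubseteq> y"
proof -
  have y: "y \<in> carrier L"
    using assms by (simp add: way_below_def)
  have "directed_in L {y}" "is_lub L y {y}"
    using y by (auto simp: directed_in_def intro!: is_lubI)
  then show ?thesis
    using assms y unfolding way_below_def by blast
qed

lemma way_below_le_trans:
  assumes xy: "way_below L x y" and le: "y \<sqsubseteq> z" and z: "z \<in> carrier L"
  shows "way_below L x z"
  unfolding way_below_def
proof (intro conjI allI impI)
  show "x \<in> carrier L"
    using xy by (simp add: way_below_def)
  fix D s assume D: "directed_in L D" "is_lub L s D" "z \<sqsubseteq> s"
  have "y \<sqsubseteq> s"
    using le_trans[OF le D(3)] xy z is_lub_carrier[OF D(2)] by (simp add: way_below_def)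
  then show "\<exists>w\<in>D. x \<sqsubseteq> w"
    using xy D unfolding way_below_def by blast
qed (rule z)

lemma le_way_below_trans:
  assumes le: "x \<sqsubseteq> y" and yz: "way_below L y z" and x: "x \<in> carrier L"
  shows "way_below L x z"
  unfolding way_below_def
proof (intro conjI allI impI)
  show "z \<in> carrier L"
    using yz by (simp add: way_below_def)
  fix D s assume D: "directed_in L D" "is_lub L s D" "z \<sqsubseteq> s"
  then obtain w where w: "w \<in> D" "y \<sqsubseteq> w"
    using yz unfolding way_below_def by blast
  moreover have "w \<in> carrier L" "y \<in> carrier L"
    using w D(1) yz by (auto simp: directed_in_def way_below_def)
  ultimately show "\<exists>w\<in>D. x \<sqsubseteq> w"
    using le_trans[OF le] x by blast
qed (rule x)

lemma up_closure_subset_Scott_open: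
  "\<lbrakk>Scott_open L W; E \<subseteq> W\<rbrakk> \<Longrightarrow> up_closure L E \<subseteq> W"
  unfolding up_closure_def Scott_open_def by blast

lemma way_above_subset_up_closure: "way_above L E \<subseteq> up_closure L E"
  using way_below_imp_le by (auto simp: way_above_def up_closure_def way_below_def)

end

text \<open>Interpolation in disguise: for a directed \<open>D\<close> with supremum
  \<open>s\<close>, the set \<open>A\<close> of all elements way below some member of
  \<open>D\<close> is again directed with supremum \<open>s\<close>. So \<open>b\<close> way below
  \<open>s\<close> lies under an element of \<open>A\<close>, hence is way below a member of
  \<open>D\<close>.\<close>

lemma Scott_open_way_above:
  assumes "continuous_dcpo L"
  shows "Scott_open L (way_above L E)"
proof -
  interpret partial_order L
    using assms by (simp add: continuous_dcpo_def dcpo_def)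
  have approx: "directed_in L {y. way_below L y x}" "is_lub L x {y. way_below L y x}"
    if "x \<in> carrier L" for x
    using assms that by (auto simp: continuous_dcpo_def)
  have "\<exists>z\<in>D. way_below L b z"
    if D: "directed_in L D" "is_lub L s D" and b: "way_below L b s" for D s b
  proof -
    have D_car: "D \<subseteq> carrier L" and "D \<noteq> {}"
      using D(1) by (auto simp: directed_in_def)
    define A where "A = {y. \<exists>z\<in>D. way_below L y z}"
    have A_car: "A \<subseteq> carrier L"
      by (auto simp: A_def way_below_def)
    have "directed_in L A"
      unfolding directed_in_def
    proof (intro conjI ballI)
      obtain z where "z \<in> D" using \<open>D \<noteq> {}\<close> by blast
      then show "A \<noteq> {}"
        using approx(1)[of z] D_car unfolding A_def directed_in_def by blast
    next
      fix x y assume "x \<in> A" "y \<in> A"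
      then obtain u v where uv: "u \<in> D" "way_below L x u" "v \<in> D" "way_below L y v"
        by (auto simp: A_def)
      then obtain w where w: "w \<in> D" "u \<sqsubseteq>\<^bsub>L\<^esub> w" "v \<sqsubseteq>\<^bsub>L\<^esub> w"
        using D(1) unfolding directed_in_def by blast
      then have "way_below L x w" "way_below L y w"
        using uv D_car way_below_le_trans by blast+
      then obtain t where "way_below L t w" "x \<sqsubseteq>\<^bsub>L\<^esub> t" "y \<sqsubseteq>\<^bsub>L\<^esub> t"
        using approx(1)[of w] w(1) D_car unfolding directed_in_def by blast
      then show "\<exists>t\<in>A. x \<sqsubseteq>\<^bsub>L\<^esub> t \<and> y \<sqsubseteq>\<^bsub>L\<^esub> t"
        using w(1) by (auto simp: A_def)
    qed (rule A_car)
    moreover have "is_lub L s A"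
    proof (rule is_lubI)
      show s: "s \<in> carrier L"
        using D(2) by (rule is_lub_carrier)
      show "x \<sqsubseteq>\<^bsub>L\<^esub> s" if "x \<in> A" for x
      proof -
        obtain z where z: "z \<in> D" "way_below L x z"
          using \<open>x \<in> A\<close> by (auto simp: A_def)
        then show ?thesis
          using way_below_imp_le way_below_le_trans is_lub_upper[OF D(2) z(1) D_car] s by blast
      qed
      \<comment> \<open>An upper bound of \<open>A\<close> bounds each \<open>z\<close> in
        \<open>D\<close>, because \<open>z\<close> is the supremum of its own approximants and these
        all lie in \<open>A\<close>.\<close>
      fix y assume y: "y \<in> carrier L" and ub: "\<And>x. \<lbrakk>x \<in> A; x \<in> carrier L\<rbrakk> \<Longrightarrow> x \<sqsubseteq>\<^bsub>L\<^esub> y"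
      show "s \<sqsubseteq>\<^bsub>L\<^esub> y"
      proof (rule is_lub_least[OF D(2) D_car y])
        fix z assume z: "z \<in> D"
        then have zc: "z \<in> carrier L"
          using D_car by blast
        show "z \<sqsubseteq>\<^bsub>L\<^esub> y"
        proof (rule is_lub_least[OF approx(2)[OF zc] _ y])
          show "{y. way_below L y z} \<subseteq> carrier L"
            by (auto simp: way_below_def)
          show "x \<sqsubseteq>\<^bsub>L\<^esub> y" if "x \<in> {y. way_below L y z}" for x
            using that z A_car ub unfolding A_def by blast
        qed
      qed
    qed
    moreover have "s \<sqsubseteq>\<^bsub>L\<^esub> s"
      using is_lub_carrier[OF D(2)] by simp
    ultimately obtain a where "a \<in> A" "b \<sqsubseteq>\<^bsub>L\<^esub> a"
      using b unfolding way_below_def by blast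
    moreover have "b \<in> carrier L"
      using b by (simp add: way_below_def)
    ultimately show ?thesis
      using le_way_below_trans unfolding A_def by blast
  qed
  moreover have "way_above L E \<subseteq> carrier L"
    by (auto simp: way_above_def way_below_def)
  ultimately show ?thesis
    unfolding Scott_open_def way_above_def using way_below_le_trans by blast
qed

text \<open>\<open>x\<close> is the supremum of the directed set of its approximants, and a
  Scott-open set containing \<open>x\<close> must meet that set.\<close>

lemma Scott_open_subset_way_above:
  assumes "continuous_dcpo L" "Scott_open L W" "x \<in> W"
  shows "\<exists>b\<in>W. way_below L b x"
proof -
  have "x \<in> carrier L"
    using assms by (auto simp: Scott_open_def)
  then have "directed_in L {y. way_below L y x}" "is_lub L x {y. way_below L y x}"
    using assms(1) by (auto simp: continuous_dcpo_def)
  then show ?thesis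
    using assms(2,3) unfolding Scott_open_def by blast
qed

subsection \<open>Well-filteredness for sequences of finite sets\<close>

text \<open>Only predecessors are assumed to exist, so a greedy forward choice may get stuck. The
  chain is kept among elements satisfying \<open>P\<close>, those from which paths reach every later
  layer.\<close>

lemma Koenig_chain:
  fixes F :: "nat \<Rightarrow> 'a set"
  assumes fin: "\<And>n. finite (F n)" and ne: "\<And>n. F n \<noteq> {}"
    and pred: "\<And>n y. y \<in> F (Suc n) \<Longrightarrow> \<exists>x\<in>F n. R x y"
  shows "\<exists>f. \<forall>n. f n \<in> F n \<and> R (f n) (f (Suc n))"
proof -
  \<comment> \<open>\<open>g\<close> is total but constrained only on \<open>{n..m}\<close>, so a
    path can be truncated at either end or extended by a function update.\<close>
  define path where
    "path n m g \<longleftrightarrow> (\<forall>i\<in>{n..m}. g i \<in> F i) \<and> (\<forall>i\<in>{n..<m}. R (g i) (g (Suc i)))"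
    for n m and g :: "nat \<Rightarrow> 'a"
  define P where "P n e \<longleftrightarrow> (\<forall>m\<ge>n. \<exists>g. path n m g \<and> g n = e)" for n e
  have path_to: "\<exists>g. path 0 m g \<and> g m = y" if "y \<in> F m" for m y
    using that
  proof (induction m arbitrary: y)
    case 0
    then show ?case by (intro exI[of _ "\<lambda>_. y"]) (auto simp: path_def)
  next
    case (Suc m)
    then obtain x where x: "x \<in> F m" "R x y" using pred by blast
    then obtain g where g: "path 0 m g" "g m = x" using Suc.IH by blast
    have "path 0 (Suc m) (g(Suc m := y))"
      using g x Suc.prems unfolding path_def
      by (auto simp: le_Suc_eq less_Suc_eq)
    then show ?case by (metis fun_upd_same)
  qed
  \<comment> \<open>Layer \<open>n\<close> is finite, so infinitely many of the given paths share a
    starting point; truncating them gives paths from it to every later layer. \<open>C\<close> is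
    trivial for the first choice and \<open>R e\<close> for each later one.\<close>
  have pigeon: "\<exists>e\<in>F n. P n e \<and> C e"
    if C: "\<And>m. m \<ge> n \<Longrightarrow> \<exists>g. path n m g \<and> C (g n)" for n and C :: "'a \<Rightarrow> bool"
  proof -
    obtain g where g: "\<And>m. m \<ge> n \<Longrightarrow> path n m (g m) \<and> C (g m n)"
      using C by metis
    have "(\<lambda>m. g m n) ` {n..} \<subseteq> F n"
      using g by (auto simp: path_def)
    then have "finite ((\<lambda>m. g m n) ` {n..})"
      using fin finite_subset by blast
    then obtain m0 where m0: "m0 \<in> {n..}" "infinite {m \<in> {n..}. g m n = g m0 n}"
      using pigeonhole_infinite[of "{n..}" "\<lambda>m. g m n"] infinite_Ici by blast
    have "P n (g m0 n)"
      unfolding P_def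
    proof (intro allI impI)
      fix m assume "n \<le> m"
      obtain k where k: "k \<in> {m \<in> {n..}. g m n = g m0 n}" "m \<le> k"
        using m0(2) infinite_nat_iff_unbounded_le by blast
      then have "path n m (g k)"
        using g[of k] by (auto simp: path_def)
      then show "\<exists>h. path n m h \<and> h n = g m0 n"
        using k by auto
    qed
    moreover have "g m0 n \<in> F n" "C (g m0 n)"
      using g[of m0] m0(1) by (auto simp: path_def)
    ultimately show ?thesis by blast
  qed
  have start: "\<exists>e. P 0 e"
    using pigeon[of 0 "\<lambda>_. True"] path_to ne by (metis ex_in_conv)
  have step: "\<exists>e'. P (Suc n) e' \<and> R e e'" if e: "P n e" for n e
  proof -
    \<comment> \<open>Dropping the first vertex of a path from \<open>e\<close> leaves a path that
      starts at a successor of \<open>e\<close>.\<close>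
    have "\<exists>g. path (Suc n) m g \<and> R e (g (Suc n))" if "m \<ge> Suc n" for m
    proof -
      obtain g where "path n m g" "g n = e"
        using e \<open>m \<ge> Suc n\<close> unfolding P_def by (meson Suc_leD)
      then show ?thesis
        using that by (intro exI[of _ g]) (auto simp: path_def)
    qed
    then show ?thesis using pigeon[of "Suc n" "R e"] by blast
  qed
  obtain f where f: "\<And>n. P n (f n)" "\<And>n. R (f n) (f (Suc n))"
    using dependent_nat_choice[of P "\<lambda>_. R"] start step by metis
  have "f n \<in> F n" for n
    using f(1)[of n] by (auto simp: P_def path_def)
  then show ?thesis using f(2) by blast
qed

text \<open>If no \<open>E n\<close> fits into \<open>W\<close>, the finite sets
  \<open>E n - W\<close> are non-empty, and whatever lies below a point outside the upper set
  \<open>W\<close> is outside too. Koenig's lemma then gives an increasing sequence avoiding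
  \<open>W\<close>; its supremum lies in every \<open>up_closure L (E n)\<close>, hence in
  \<open>W\<close>, against Scott-openness.\<close>

lemma Inter_up_closure_subset_Scott_open:
  assumes "dcpo L" and fin: "\<And>n. finite (E n)" and E_car: "\<And>n. E n \<subseteq> carrier L"
    and dec: "\<And>n. E (Suc n) \<subseteq> up_closure L (E n)"
    and W: "Scott_open L W" "(\<Inter>n. up_closure L (E n)) \<subseteq> W"
  shows "\<exists>n. E n \<subseteq> W"
proof (rule ccontr)
  assume none: "\<nexists>n. E n \<subseteq> W"
  interpret partial_order L
    using assms(1) by (simp add: dcpo_def)
  have "\<exists>f. \<forall>n. f n \<in> E n - W \<and> f n \<sqsubseteq>\<^bsub>L\<^esub> f (Suc n)"
  proof (rule Koenig_chain)
    show "finite (E n - W)" "E n - W \<noteq> {}" for n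
      using fin none by auto
    show "\<exists>x\<in>E n - W. x \<sqsubseteq>\<^bsub>L\<^esub> y" if y: "y \<in> E (Suc n) - W" for n y
    proof -
      obtain x where x: "x \<in> E n" "x \<sqsubseteq>\<^bsub>L\<^esub> y" "y \<in> carrier L"
        using y dec[of n] by (auto simp: up_closure_def)
      then have "x \<notin> W"
        using y W(1) by (auto simp: Scott_open_def)
      then show ?thesis using x by blast
    qed
  qed
  then obtain f where f: "\<And>n. f n \<in> E n - W" "\<And>n. f n \<sqsubseteq>\<^bsub>L\<^esub> f (Suc n)"
    by blast
  have fc: "f n \<in> carrier L" for n
    using f(1)[of n] E_car by blast
  have mono: "f i \<sqsubseteq>\<^bsub>L\<^esub> f j" if "i \<le> j" for i j
    using that
  proof (induction rule: dec_induct)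
    case base
    show ?case using fc by simp
  next
    case (step n)
    show ?case by (rule le_trans[OF step.IH f(2) fc fc fc])
  qed
  have "f i \<sqsubseteq>\<^bsub>L\<^esub> f (max i j)" "f j \<sqsubseteq>\<^bsub>L\<^esub> f (max i j)" for i j
    using mono by simp_all
  then have dir: "directed_in L (range f)"
    using fc unfolding directed_in_def by blast
  then obtain s where s: "is_lub L s (range f)"
    using assms(1) by (auto simp: dcpo_def)
  then have "f n \<sqsubseteq>\<^bsub>L\<^esub> s" for n
    using is_lub_upper[OF s, of "f n"] fc by blast
  then have "s \<in> up_closure L (E n)" for n
    using is_lub_carrier[OF s] f(1)[of n] by (auto simp: up_closure_def)
  then have "s \<in> W"
    using W(2) by blast
  then have "range f \<inter> W \<noteq> {}"
    using W(1) dir s unfolding Scott_open_def by blast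
  then show False
    using f(1) by blast
qed

subsection \<open>Consonance of \<open>G\<^sub>\<delta>\<close> subspaces of continuous dcpos\<close>

text \<open>The hypothesis \<open>fX\<close> acts twice: intersecting with \<open>V n\<close> leaves
  traces on \<open>X\<close> unchanged, and the set \<open>K\<close>, squeezed into every
  \<open>V n\<close>, consists of images of points of \<open>X\<close>, so it can be recovered from
  its trace \<open>Q\<close>.\<close>

lemma consonant_G_delta_pullback:
  fixes f :: "'x \<Rightarrow> 'a" and L :: "('a, 'b) gorder_scheme"
  assumes cont: "continuous_dcpo L" and V: "\<And>n::nat. Scott_open L (V n)"
    and fX: "f ` X = (\<Inter>n. V n)"
  shows "consonant (pullback_topology X f (Scott_topology L))"
  unfolding consonant_def
proof (intro allI impI ballI)
  define T where "T = pullback_topology X f (Scott_topology L)"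
  define tr where "tr W = f -` W \<inter> X" for W
  have openT: "openin T S \<longleftrightarrow> (\<exists>W. Scott_open L W \<and> S = tr W)" for S
    by (simp add: T_def openin_pullback_topology openin_Scott_topology tr_def)
  have dc: "dcpo L"
    using cont by (simp add: continuous_dcpo_def)
  interpret partial_order L
    using dc by (simp add: dcpo_def)
  have V_car: "V n \<subseteq> carrier L" for n
    using V by (simp add: Scott_open_def)
  have "f ` X \<subseteq> carrier L"
    using fX V_car by blast
  then have topT: "topspace T = X"
    by (auto simp: T_def topspace_pullback_topology topspace_Scott_topology)
  fix \<U> U assume "Scott_open (opens_lattice (pullback_topology X f (Scott_topology L))) \<U>"
    and U: "U \<in> \<U>"
  then have \<U>: "Scott_open (opens_lattice T) \<U>"
    by (simp add: T_def)
  have \<U>_up: "B \<in> \<U>" if "A \<in> \<U>" "A \<subseteq> B" "openin T B" for A B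
    using \<U> that unfolding Scott_open_def opens_lattice_def by auto
  \<comment> \<open>By continuity, \<open>tr W\<close> is the directed union of the traces of
    \<open>way_above L E\<close> over finite \<open>E \<subseteq> W\<close>; Scott-openness of
    \<open>\<U>\<close> selects one of them.\<close>
  have finite_approx: "\<exists>E. finite E \<and> E \<subseteq> W \<and> tr (way_above L E) \<in> \<U>"
    if W: "Scott_open L W" "tr W \<in> \<U>" for W
  proof -
    define D where "D = {tr (way_above L E) |E. finite E \<and> E \<subseteq> W}"
    have D_open: "openin T S" if "S \<in> D" for S
      using that Scott_open_way_above[OF cont] openT by (auto simp: D_def)
    have "directed_in (opens_lattice T) D"
      unfolding directed_in_def
    proof (intro conjI ballI)
      show "D \<subseteq> carrier (opens_lattice T)"
        using D_open by (auto simp: opens_lattice_def)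
      show "D \<noteq> {}"
        by (auto simp: D_def)
      fix A B assume "A \<in> D" "B \<in> D"
      then obtain E F where E: "finite E" "E \<subseteq> W" "A = tr (way_above L E)"
        and F: "finite F" "F \<subseteq> W" "B = tr (way_above L F)"
        by (auto simp: D_def)
      have "tr (way_above L (E \<union> F)) \<in> D"
        using E F unfolding D_def by blast
      moreover have "A \<subseteq> tr (way_above L (E \<union> F))" "B \<subseteq> tr (way_above L (E \<union> F))"
        using E F by (auto simp: tr_def way_above_def)
      ultimately show "\<exists>C\<in>D. A \<sqsubseteq>\<^bsub>opens_lattice T\<^esub> C \<and> B \<sqsubseteq>\<^bsub>opens_lattice T\<^esub> C"
        by (auto simp: opens_lattice_def)
    qed
    moreover have "is_lub (opens_lattice T) (tr W) D"
    proof (rule is_lubI)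
      show "tr W \<in> carrier (opens_lattice T)"
        using W(1) openT by (auto simp: opens_lattice_def)
    next
      fix S assume "S \<in> D"
      then obtain E where "E \<subseteq> W" "S = tr (way_above L E)"
        by (auto simp: D_def)
      moreover have "way_above L E \<subseteq> W"
        using \<open>E \<subseteq> W\<close> W(1) way_above_subset_up_closure up_closure_subset_Scott_open by blast
      ultimately show "S \<sqsubseteq>\<^bsub>opens_lattice T\<^esub> tr W"
        by (auto simp: opens_lattice_def tr_def)
    next
      fix B assume ub: "\<And>S. \<lbrakk>S \<in> D; S \<in> carrier (opens_lattice T)\<rbrakk> \<Longrightarrow> S \<sqsubseteq>\<^bsub>opens_lattice T\<^esub> B"
      have "x \<in> B" if "x \<in> tr W" for x
      proof -
        obtain b where b: "b \<in> W" "way_below L b (f x)"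
          using Scott_open_subset_way_above[OF cont W(1), of "f x"] \<open>x \<in> tr W\<close>
          by (auto simp: tr_def)
        have "finite {b} \<and> {b} \<subseteq> W"
          using b by simp
        then have "tr (way_above L {b}) \<in> D"
          unfolding D_def by blast
        then have "tr (way_above L {b}) \<subseteq> B"
          using ub D_open by (simp add: opens_lattice_def)
        moreover have "x \<in> tr (way_above L {b})"
          using b \<open>x \<in> tr W\<close> by (auto simp: tr_def way_above_def)
        ultimately show ?thesis by blast
      qed
      then show "tr W \<sqsubseteq>\<^bsub>opens_lattice T\<^esub> B"
        by (auto simp: opens_lattice_def)
    qed
    ultimately have "D \<inter> \<U> \<noteq> {}"
      using \<U> W(2) unfolding Scott_open_def by blast
    then show ?thesis
      by (auto simp: D_def)
  qed
  have "\<U> \<subseteq> {S. openin T S}"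
    using \<U> by (simp add: Scott_open_def opens_lattice_def)
  then obtain W0 where W0: "Scott_open L W0" "U = tr W0"
    using U openT by blast
  define good where "good E \<longleftrightarrow> finite E \<and> E \<subseteq> carrier L \<and> tr (way_above L E) \<in> \<U>" for E
  \<comment> \<open>The clause guarded by \<open>n = 0\<close> carries the initial condition through
    the recursive choice. The set \<open>V n\<close> constrains \<open>E (Suc n)\<close>, so
    \<open>E 0\<close> is confined only to \<open>W0\<close>.\<close>
  have "\<exists>E. \<forall>n. (good (E n) \<and> (n = 0 \<longrightarrow> E n \<subseteq> W0)) \<and> E (Suc n) \<subseteq> way_above L (E n) \<inter> V n"
  proof (rule dependent_nat_choice)
    have "W0 \<subseteq> carrier L"
      using W0(1) by (simp add: Scott_open_def)
    then show "\<exists>E. good E \<and> (0 = (0::nat) \<longrightarrow> E \<subseteq> W0)"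
      using finite_approx[OF W0(1)] U W0(2) by (auto simp: good_def)
  next
    fix E and n :: nat assume E: "good E \<and> (n = 0 \<longrightarrow> E \<subseteq> W0)"
    have op: "Scott_open L (way_above L E \<inter> V n)"
      using Scott_open_way_above[OF cont] V istopology_Scott_open[of L]
      by (auto simp: istopology_def)
    have "tr (way_above L E \<inter> V n) = tr (way_above L E)"
      using fX by (auto simp: tr_def)
    then obtain F where "finite F" "F \<subseteq> way_above L E \<inter> V n" "tr (way_above L F) \<in> \<U>"
      using finite_approx[OF op] E by (auto simp: good_def)
    then have "good F" "F \<subseteq> way_above L E \<inter> V n"
      using V_car[of n] by (auto simp: good_def)
    then show "\<exists>F. (good F \<and> (Suc n = 0 \<longrightarrow> F \<subseteq> W0)) \<and> F \<subseteq> way_above L E \<inter> V n"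
      by blast
  qed
  then obtain E where E: "\<And>n. good (E n)" "E 0 \<subseteq> W0"
    and E_step: "\<And>n. E (Suc n) \<subseteq> way_above L (E n) \<inter> V n"
    by metis
  define K where "K = (\<Inter>n. up_closure L (E n))"
  define Q where "Q = tr K"
  have E_in: "\<exists>n. E n \<subseteq> W" if "Scott_open L W" "K \<subseteq> W" for W
  proof (rule Inter_up_closure_subset_Scott_open[OF dc _ _ _ that(1)])
    show "E (Suc n) \<subseteq> up_closure L (E n)" for n
      using E_step[of n] way_above_subset_up_closure by blast
  qed (use E(1) that(2) in \<open>auto simp: good_def K_def\<close>)
  have "up_closure L (E (Suc n)) \<subseteq> V n" for n
    using E_step[of n] V up_closure_subset_Scott_open by blast
  then have K_fX: "K \<subseteq> f ` X"
    unfolding fX K_def by blast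
  \<comment> \<open>Every point of \<open>K\<close> is \<open>f x\<close> for some \<open>x\<close>
    in \<open>Q\<close>, so an inclusion of traces lifts to \<open>L\<close>.\<close>
  have K_sub: "K \<subseteq> W" if "Q \<subseteq> tr W" for W
    using that K_fX unfolding Q_def tr_def by blast
  have comp: "\<exists>n. E n \<subseteq> W" if "Scott_open L W" "Q \<subseteq> tr W" for W
    using E_in K_sub that by blast
  have "compactin T Q"
    unfolding compactin_def
  proof (intro conjI allI impI)
    show "Q \<subseteq> topspace T"
      by (auto simp: topT Q_def tr_def)
    \<comment> \<open>The cover lifts to Scott-open sets \<open>w S\<close>, whose union contains
      some \<open>E n\<close>. Finitely many \<open>w S\<close> contain this finite set, and being
      upper sets they also contain \<open>f x\<close> for every \<open>x\<close> in
      \<open>Q\<close>.\<close>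
    fix \<C> assume \<C>: "Ball \<C> (openin T) \<and> Q \<subseteq> \<Union>\<C>"
    then obtain w where w: "\<And>S. S \<in> \<C> \<Longrightarrow> Scott_open L (w S) \<and> S = tr (w S)"
      using openT by metis
    have "Scott_open L (\<Union>(w ` \<C>))"
      using w istopology_Scott_open[of L] by (auto simp: istopology_def)
    moreover have "Q \<subseteq> tr (\<Union>(w ` \<C>))"
      using \<C> w by (fastforce simp: tr_def)
    ultimately obtain n where n: "E n \<subseteq> \<Union>(w ` \<C>)"
      using comp by blast
    have "finite (E n)"
      using E(1) by (simp add: good_def)
    then obtain \<F> where F: "\<F> \<subseteq> \<C>" "finite \<F>" "E n \<subseteq> \<Union>(w ` \<F>)"
      using n by (metis finite_subset_Union finite_subset_image)
    have "x \<in> \<Union>\<F>" if x: "x \<in> Q" for x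
    proof -
      obtain b where b: "b \<in> E n" "b \<sqsubseteq>\<^bsub>L\<^esub> f x" "f x \<in> carrier L" "x \<in> X"
        using x by (auto simp: Q_def K_def tr_def up_closure_def)
      then obtain S where S: "S \<in> \<F>" "b \<in> w S"
        using F by blast
      then have "f x \<in> w S"
        using w[of S] F(1) b unfolding Scott_open_def by blast
      then show ?thesis
        using w[of S] F(1) S b by (auto simp: tr_def)
    qed
    then show "\<exists>\<F>. finite \<F> \<and> \<F> \<subseteq> \<C> \<and> Q \<subseteq> \<Union>\<F>"
      using F by blast
  qed
  moreover have "saturated_in T Q"
    unfolding saturated_in_def
  proof (intro exI conjI)
    show "\<forall>S\<in>range (\<lambda>n. tr (way_above L (E n))). openin T S"
      using Scott_open_way_above[OF cont] openT by blast
    \<comment> \<open>The two decreasing sequences interleave: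
      \<open>up_closure L (E (Suc n))\<close> lies in \<open>way_above L (E n)\<close>, which lies
      in \<open>up_closure L (E n)\<close>. So \<open>Q\<close> is also an intersection of open
      sets.\<close>
    have "K = (\<Inter>n. way_above L (E n))"
    proof
      have "up_closure L (E (Suc n)) \<subseteq> way_above L (E n)" for n
        using up_closure_subset_Scott_open[OF Scott_open_way_above[OF cont]] E_step[of n] by blast
      then show "K \<subseteq> (\<Inter>n. way_above L (E n))"
        by (auto simp: K_def)
      show "(\<Inter>n. way_above L (E n)) \<subseteq> K"
        using way_above_subset_up_closure by (auto simp: K_def)
    qed
    then show "Q = topspace T \<inter> \<Inter>(range (\<lambda>n. tr (way_above L (E n))))"
      by (auto simp: topT Q_def tr_def)
  qed
  moreover have "Q \<subseteq> U"
    using up_closure_subset_Scott_open[OF W0(1) E(2)] W0(2) by (auto simp: Q_def K_def tr_def)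
  \<comment> \<open>An open neighbourhood of \<open>Q\<close> contains the trace of some
    \<open>way_above L (E n)\<close>, a member of \<open>\<U>\<close> since \<open>E n\<close> is
    \<open>good\<close>.\<close>
  moreover have "S \<in> \<U>" if "openin T S" "Q \<subseteq> S" for S
  proof -
    obtain W where W: "Scott_open L W" "S = tr W"
      using \<open>openin T S\<close> openT by blast
    then obtain n where "E n \<subseteq> W"
      using comp \<open>Q \<subseteq> S\<close> by blast
    then have "way_above L (E n) \<subseteq> W"
      using W(1) way_above_subset_up_closure up_closure_subset_Scott_open by blast
    then have "tr (way_above L (E n)) \<subseteq> S"
      using W by (auto simp: tr_def)
    then show ?thesis
      using \<U>_up E(1) \<open>openin T S\<close> by (auto simp: good_def)
  qed
  ultimately show "\<exists>Q. compactin (pullback_topology X f (Scott_topology L)) Q \<and>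
      saturated_in (pullback_topology X f (Scott_topology L)) Q \<and> Q \<subseteq> U \<and>
      (\<forall>S. openin (pullback_topology X f (Scott_topology L)) S \<longrightarrow> Q \<subseteq> S \<longrightarrow> S \<in> \<U>)"
    unfolding T_def by blast
qed

subsection \<open>Formal balls\<close>

text \<open>Radii decrease along the order, which gives upward closure. The other half says, over
  all \<open>\<epsilon>\<close>, that a directed supremum has the infimum of the radii as its
  radius; completeness enters by giving the shifted set \<open>sh\<close> a supremum.\<close>

lemma (in Quasi_metric_space) Scott_open_radius_less:
  assumes "Yoneda_complete X d"
  shows "Scott_open (formal_balls X d) (X \<times> {0..<\<epsilon>})"
proof -
  let ?B = "formal_balls X d"
  have car: "carrier ?B = X \<times> {0..}"
    by (simp add: formal_balls_def)
  have le: "(x, r) \<sqsubseteq>\<^bsub>?B\<^esub> (y, s) \<longleftrightarrow> enn2ereal (d x y) \<le> ereal (r - s)" for x y r s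
    by (simp add: formal_balls_def)
  have radius_le: "s \<le> r" if "(x, r) \<sqsubseteq>\<^bsub>?B\<^esub> (y, s)" for x y r s
  proof -
    have "0 \<le> ereal (r - s)"
      using that enn2ereal_nonneg order_trans unfolding le by blast
    then show ?thesis by simp
  qed
  have radius_reached: "\<exists>a\<in>D. snd a < \<epsilon>"
    if D: "directed_in ?B D" and lub: "is_lub ?B (x, r) D" and r: "r < \<epsilon>" for D x r
  proof (rule ccontr)
    \<comment> \<open>Otherwise all radii in \<open>D\<close> can be decreased by \<open>\<epsilon>\<close>; enlarging a supremum of the resulting
      set by \<open>\<epsilon>\<close> gives an upper bound of \<open>D\<close> of radius at least \<open>\<epsilon>\<close>.\<close>
    assume "\<not> (\<exists>a\<in>D. snd a < \<epsilon>)"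
    then have ge: "\<epsilon> \<le> s" if "(y, s) \<in> D" for y s
      using that by force
    have D_car: "D \<subseteq> carrier ?B"
      using D by (simp add: directed_in_def)
    have "0 \<le> r"
      using is_lub_carrier[OF lub] by (simp add: car)
    then have "0 < \<epsilon>"
      using r by simp
    define sh where "sh = (\<lambda>(y, s). (y, s - \<epsilon>)) ` D"
    have sh_iff: "(y, s) \<in> sh \<longleftrightarrow> (y, s + \<epsilon>) \<in> D" for y s
      by (force simp: sh_def)
    have "directed_in ?B sh"
      unfolding directed_in_def
    proof (intro conjI ballI)
      show "sh \<subseteq> carrier ?B"
        using D_car ge by (fastforce simp: sh_def car)
      show "sh \<noteq> {}"
        using D by (auto simp: sh_def directed_in_def)
      fix a b assume "a \<in> sh" "b \<in> sh"
      then obtain y s z t where ab: "a = (y, s - \<epsilon>)" "b = (z, t - \<epsilon>)" "(y, s) \<in> D" "(z, t) \<in> D"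
        by (auto simp: sh_def)
      then obtain w u where "(w, u) \<in> D" "(y, s) \<sqsubseteq>\<^bsub>?B\<^esub> (w, u)" "(z, t) \<sqsubseteq>\<^bsub>?B\<^esub> (w, u)"
        using D unfolding directed_in_def by fast
      \<comment> \<open>The order depends on radii only through their difference, so a common shift
        preserves it.\<close>
      then show "\<exists>c\<in>sh. a \<sqsubseteq>\<^bsub>?B\<^esub> c \<and> b \<sqsubseteq>\<^bsub>?B\<^esub> c"
        by (intro bexI[of _ "(w, u - \<epsilon>)"]) (auto simp: ab le sh_iff)
    qed
    then obtain c where lub_c: "is_lub ?B c sh"
      using assms by (auto simp: Yoneda_complete_def dcpo_def)
    then obtain y s where ys: "is_lub ?B (y, s) sh" "y \<in> X" "0 \<le> s"
      using is_lub_carrier[OF lub_c] by (auto simp: car)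
    have sh_car: "sh \<subseteq> carrier ?B"
      using \<open>directed_in ?B sh\<close> by (simp add: directed_in_def)
    have "(x, r) \<sqsubseteq>\<^bsub>?B\<^esub> (y, s + \<epsilon>)"
    proof (rule is_lub_least[OF lub D_car])
      show "(y, s + \<epsilon>) \<in> carrier ?B"
        using ys \<open>0 < \<epsilon>\<close> by (simp add: car)
      fix a assume a: "a \<in> D"
      obtain z t where zt: "a = (z, t)" by fastforce
      then have "(z, t - \<epsilon>) \<sqsubseteq>\<^bsub>?B\<^esub> (y, s)"
        using is_lub_upper[OF ys(1) _ sh_car] a by (simp add: sh_iff)
      then show "a \<sqsubseteq>\<^bsub>?B\<^esub> (y, s + \<epsilon>)"
        by (simp add: zt le algebra_simps)
    qed
    \<comment> \<open>Monotonicity of radii would force \<open>s + \<epsilon> \<le> r\<close>,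
      although \<open>r < \<epsilon>\<close> and \<open>0 \<le> s\<close>.\<close>
    then show False
      using radius_le r ys(3) by fastforce
  qed
  have "D \<inter> X \<times> {0..<\<epsilon>} \<noteq> {}"
    if "directed_in ?B D" "is_lub ?B a D" "a \<in> X \<times> {0..<\<epsilon>}" for D a
  proof -
    obtain x r where "a = (x, r)" "r < \<epsilon>"
      using \<open>a \<in> X \<times> {0..<\<epsilon>}\<close> by auto
    then obtain b where "b \<in> D" "snd b < \<epsilon>"
      using radius_reached \<open>directed_in ?B D\<close> \<open>is_lub ?B a D\<close> by blast
    moreover have "D \<subseteq> X \<times> {0..}"
      using \<open>directed_in ?B D\<close> by (simp add: directed_in_def car)
    ultimately show ?thesis
      by (cases b) fastforce
  qed
  moreover have "b \<in> X \<times> {0..<\<epsilon>}"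
    if "a \<in> X \<times> {0..<\<epsilon>}" "b \<in> carrier ?B" "a \<sqsubseteq>\<^bsub>?B\<^esub> b" for a b
    using that radius_le[of "fst a" "snd a" "fst b" "snd b"] by (auto simp: car)
  moreover have "X \<times> {0..<\<epsilon>} \<subseteq> carrier ?B"
    by (auto simp: car)
  ultimately show ?thesis
    unfolding Scott_open_def by blast
qed

theorem proposition7p2:
  fixes X :: "'a set" and d :: "'a \<Rightarrow> 'a \<Rightarrow> ennreal"
  assumes "Quasi_metric_space X d"
    and "continuous_Yoneda_complete X d"
  shows "consonant (d_Scott_topology X d)"
  unfolding d_Scott_topology_def
proof (rule consonant_G_delta_pullback)
  show cont: "continuous_dcpo (formal_balls X d)"
    using assms(2) by (simp add: continuous_Yoneda_complete_def)
  \<comment> \<open>\<open>Suc n\<close> keeps the bound positive: \<open>inverse 0 = 0\<close>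
    would make the set for index 0 empty. By the Archimedean property only radius 0 survives in the
    intersection.\<close>
  show "Scott_open (formal_balls X d) (X \<times> {0..<inverse (real (Suc n))})" for n
    using Quasi_metric_space.Scott_open_radius_less[OF assms(1)] cont
    by (simp add: Yoneda_complete_def continuous_dcpo_def)
  have "r = 0" if "0 \<le> r" "\<And>n. r < inverse (real (Suc n))" for r :: real
    using that reals_Archimedean[of r] by (metis less_asym order_le_less)
  then show "(\<lambda>x. (x, 0)) ` X = (\<Inter>n. X \<times> {0..<inverse (real (Suc n))})"
    by (auto simp del: of_nat_Suc)
qed

end
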